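(* Let $D$ be a finite generalized digroup, fix a bar-unit $\xi\in\mathrm{Halo}(D)$, and identify $D\simeq G\times E$ with $G=G_l^{\xi}$ and $E=\mathrm{Halo}(D)$ by the structure isomorphism recalled in the context. For $g\in G$ let $\mathrm{Fix}_E(g):=\{\beta\in E\mid g\bullet\beta=\beta\}$ and let $C_G(g):=\{h\in G\mid gh=hg\}$ be the centralizer of $g$ in $G$. Define $$\Phi_D(t):=\sum_{x\in D}t^{|\mathrm{Fix}(L_x)|},$$ where $L_x$ is the left translation by $x$ in $\mathrm{Conj}(D)$ and $\mathrm{Fix}(L_x)$ is its set of fixed points. Then $$\Phi_D(t)=|E|\sum_{g\in G}t^{\,|C_G(g)|\,|\mathrm{Fix}_E(g)|}.$$
   Context: A generalized digroup is a nonempty set $D$ with two associative binary operations $\vdash,\dashv$ satisfying $x\vdash(y\dashv z)=(x\vdash y)\dashv z$, $x\dashv(y\dashv z)=x\dashv(y\vdash z)$, $(x\vdash y)\vdash z=(x\dashv y)\vdash z$, such that there is at least one bar-unit (an element $\xi$ with $x\dashv\xi=x=\xi\vdash x$ for all $x\in D$), and for every bar-unit $\xi$ and every $x\in D$ there are $x^{-1}_{r,\xi},x^{-1}_{l,\xi}\in D$ with $x\vdash x^{-1}_{r,\xi}=\xi$ and $x^{-1}_{l,\xi}\dashv x=\xi$. $\mathrm{Halo}(D)$ is the set of bar-units. Structure isomorphism (known): fix a bar-unit $\xi$. Let $G:=G_l^\xi=\{\xi\dashv x\mid x\in D\}$, the left group associated with $\xi$; it is a group under $\dashv$ with identity $\xi$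 (law written multiplicatively). Let $E:=\mathrm{Halo}(D)$, a left $G$-set via $g\bullet\alpha:=g\vdash\alpha\dashv g^{-1}$ ($g^{-1}$ the inverse in $G$). Then $G\times E$ with $(g,\alpha)\vdash(h,\beta)=(gh,g\bullet\beta)$ and $(g,\alpha)\dashv(h,\beta)=(gh,\alpha)$ is a generalized digroup, and $x\mapsto(\xi\dashv x,\ x\dashv x^{-1}_{l,\xi})$ is an isomorphism $D\to G\times E$, used to identify them. The conjugation rack $\mathrm{Conj}(D)$ is the set $D$ with $x\triangleright y:=(x\vdash y)\dashv x^{-1}$, where $x^{-1}$ is any one-sided inverse of $x$ (right for $\vdash$ or left for $\dashv$) relative to a bar-unit; this is independent of the choice and is a rack, i.e. each left translation $L_x(y)=x\triangleright y$ is bijective and $x\triangleright(y\triangleright z)=(x\triangleright y)\triangleright(x\triangleright z)$. *)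

theory Defs
  imports "HOL-Algebra.Group" "HOL-Computational_Algebra.Polynomial"
begin

record 'a digroup = "'a partial_object" +
  lprod :: "'a \<Rightarrow> 'a \<Rightarrow> 'a" (infixl \<open>\<turnstile>\<index>\<close> 70)
  rprod :: "'a \<Rightarrow> 'a \<Rightarrow> 'a" (infixl \<open>\<stileturn>\<index>\<close> 70)

definition halo :: "('a, 'm) digroup_scheme \<Rightarrow> 'a set" where
  "halo D = {\<xi> \<in> carrier D. \<forall>x \<in> carrier D. x \<stileturn>\<^bsub>D\<^esub> \<xi> = x \<and> \<xi> \<turnstile>\<^bsub>D\<^esub> x = x}"

locale generalized_digroup =
  fixes D (structure)
  assumes nonempty: "carrier D \<noteq> {}"
    and lprod_closed: "\<lbrakk>x \<in> carrier D; y \<in> carrier D\<rbrakk> \<Longrightarrow> x \<turnstile> y \<in> carrier D"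
    and rprod_closed: "\<lbrakk>x \<in> carrier D; y \<in> carrier D\<rbrakk> \<Longrightarrow> x \<stileturn> y \<in> carrier D"
    and lprod_assoc: "\<lbrakk>x \<in> carrier D; y \<in> carrier D; z \<in> carrier D\<rbrakk>
      \<Longrightarrow> (x \<turnstile> y) \<turnstile> z = x \<turnstile> (y \<turnstile> z)"
    and rprod_assoc: "\<lbrakk>x \<in> carrier D; y \<in> carrier D; z \<in> carrier D\<rbrakk>
      \<Longrightarrow> (x \<stileturn> y) \<stileturn> z = x \<stileturn> (y \<stileturn> z)"
    and inner_assoc: "\<lbrakk>x \<in> carrier D; y \<in> carrier D; z \<in> carrier D\<rbrakk>
      \<Longrightarrow> x \<turnstile> (y \<stileturn> z) = (x \<turnstile> y) \<stileturn> z"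
    and right_bar: "\<lbrakk>x \<in> carrier D; y \<in> carrier D; z \<in> carrier D\<rbrakk>
      \<Longrightarrow> x \<stileturn> (y \<stileturn> z) = x \<stileturn> (y \<turnstile> z)"
    and left_bar: "\<lbrakk>x \<in> carrier D; y \<in> carrier D; z \<in> carrier D\<rbrakk>
      \<Longrightarrow> (x \<turnstile> y) \<turnstile> z = (x \<stileturn> y) \<turnstile> z"
    and halo_nonempty: "halo D \<noteq> {}"
    and right_inverse: "\<lbrakk>\<xi> \<in> halo D; x \<in> carrier D\<rbrakk> \<Longrightarrow> \<exists>y \<in> carrier D. x \<turnstile> y = \<xi>"
    and left_inverse: "\<lbrakk>\<xi> \<in> halo D; x \<in> carrier D\<rbrakk> \<Longrightarrow> \<exists>y \<in> carrier D. y \<stileturn> x = \<xi>"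

definition left_group :: "('a, 'm) digroup_scheme \<Rightarrow> 'a \<Rightarrow> 'a monoid" where
  "left_group D \<xi> = \<lparr>carrier = {\<xi> \<stileturn>\<^bsub>D\<^esub> x | x. x \<in> carrier D}, monoid.mult = (\<stileturn>\<^bsub>D\<^esub>), one = \<xi>\<rparr>"

definition halo_action :: "('a, 'm) digroup_scheme \<Rightarrow> 'a \<Rightarrow> 'a \<Rightarrow> 'a \<Rightarrow> 'a" where
  "halo_action D \<xi> g \<alpha> = (g \<turnstile>\<^bsub>D\<^esub> \<alpha>) \<stileturn>\<^bsub>D\<^esub> (inv\<^bsub>left_group D \<xi>\<^esub> g)"

definition one_sided_inverse :: "('a, 'm) digroup_scheme \<Rightarrow> 'a \<Rightarrow> 'a \<Rightarrow> bool" where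
  "one_sided_inverse D x y \<longleftrightarrow> y \<in> carrier D \<and>
     (\<exists>\<zeta> \<in> halo D. x \<turnstile>\<^bsub>D\<^esub> y = \<zeta> \<or> y \<stileturn>\<^bsub>D\<^esub> x = \<zeta>)"

text \<open>Lemma \<open>conj_op_eq\<close> below shows that the choice of the inverse does not matter.\<close>

definition conj_op :: "('a, 'm) digroup_scheme \<Rightarrow> 'a \<Rightarrow> 'a \<Rightarrow> 'a" (infixl \<open>\<triangleright>\<index>\<close> 70) where
  "x \<triangleright>\<^bsub>D\<^esub> y = (x \<turnstile>\<^bsub>D\<^esub> y) \<stileturn>\<^bsub>D\<^esub> (SOME z. one_sided_inverse D x z)"

definition left_translation :: "('a, 'm) digroup_scheme \<Rightarrow> 'a \<Rightarrow> 'a \<Rightarrow> 'a" where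
  "left_translation D x = (\<lambda>y. x \<triangleright>\<^bsub>D\<^esub> y)"

definition fixed_points :: "'a set \<Rightarrow> ('a \<Rightarrow> 'a) \<Rightarrow> 'a set" where
  "fixed_points S f = {y \<in> S. f y = y}"

definition centralizer :: "('a, 'm) monoid_scheme \<Rightarrow> 'a \<Rightarrow> 'a set" where
  "centralizer G g = {h \<in> carrier G. g \<otimes>\<^bsub>G\<^esub> h = h \<otimes>\<^bsub>G\<^esub> g}"

definition Phi :: "('a, 'm) digroup_scheme \<Rightarrow> int poly" where
  "Phi D = (\<Sum>x \<in> carrier D. monom 1 (card (fixed_points (carrier D) (left_translation D x))))"

context generalized_digroup
begin

lemma rprod_right_inverse_cancel:
  assumes "a \<in> carrier D" "x \<in> carrier D" "z \<in> carrier D" "x \<turnstile> z \<in> halo D"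
  shows "(a \<stileturn> x) \<stileturn> z = a"
  using assms rprod_assoc right_bar by (auto simp: halo_def)

lemma rprod_left_inverse_cancel:
  assumes "a \<in> carrier D" "x \<in> carrier D" "z \<in> carrier D" "z \<stileturn> x \<in> halo D"
  shows "(a \<stileturn> z) \<stileturn> x = a"
  using assms rprod_assoc by (auto simp: halo_def)

lemma rprod_one_sided_inverse_unique:
  assumes a: "a \<in> carrier D" and x: "x \<in> carrier D"
    and z: "one_sided_inverse D x z" and w: "one_sided_inverse D x w"
  shows "a \<stileturn> z = a \<stileturn> w"
proof -
  obtain \<xi> where \<xi>: "\<xi> \<in> halo D" using halo_nonempty by blast
  obtain r where r: "r \<in> carrier D" "x \<turnstile> r \<in> halo D" using right_inverse[OF \<xi> x] \<xi> by metis
  obtain l where l: "l \<in> carrier D" "l \<stileturn> x \<in> halo D" using left_inverse[OF \<xi> x] \<xi> by metis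
  have "a \<stileturn> v = a \<stileturn> l" if v: "one_sided_inverse D x v" for v
  proof -
    have vc: "v \<in> carrier D" and "x \<turnstile> v \<in> halo D \<or> v \<stileturn> x \<in> halo D"
      using v by (auto simp: one_sided_inverse_def)
    then show ?thesis
    proof (elim disjE)
      assume "x \<turnstile> v \<in> halo D"
      then show ?thesis
        using rprod_right_inverse_cancel[of "a \<stileturn> l" x v] rprod_left_inverse_cancel[of a x l]
          a x l vc rprod_closed by simp
    next
      assume "v \<stileturn> x \<in> halo D"
      then show ?thesis
        using rprod_right_inverse_cancel[of "a \<stileturn> v" x r] rprod_left_inverse_cancel[of a x v]
          rprod_right_inverse_cancel[of "a \<stileturn> l" x r] rprod_left_inverse_cancel[of a x l]
          a x l r vc rprod_closed by simp
    qed
  qed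
  then show ?thesis using z w by metis
qed

lemma conj_op_eq:
  assumes "x \<in> carrier D" "y \<in> carrier D" "one_sided_inverse D x z"
  shows "x \<triangleright> y = (x \<turnstile> y) \<stileturn> z"
  unfolding conj_op_def
  using assms someI[of "one_sided_inverse D x", OF assms(3)]
  by (intro rprod_one_sided_inverse_unique[of _ x] lprod_closed)

end

end

theory Submission
  imports Defs
begin

text \<open>
  In the coordinates \<open>(g, \<alpha>) \<mapsto> \<alpha> \<stileturn> g\<close>, the inverse of the structure isomorphism, one finds
  \<open>(\<alpha> \<stileturn> g) \<triangleright> (\<beta> \<stileturn> h) = (g \<bullet> \<beta>) \<stileturn> (g h g\<^sup>-\<^sup>1)\<close>. Hence the fixed points of a left translation
  correspond to \<open>C\<^sub>G(g) \<times> Fix\<^sub>E(g)\<close>, independently of \<open>\<alpha>\<close>, and summing over \<open>\<alpha>\<close> yields the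
  factor \<open>|E|\<close>.
\<close>

locale pointed_digroup = generalized_digroup D for D (structure) +
  fixes \<xi>
  assumes base_in_halo: "\<xi> \<in> halo D"
begin

abbreviation "G \<equiv> left_group D \<xi>"

abbreviation action (infixr \<open>\<bullet>\<close> 75) where "g \<bullet> \<alpha> \<equiv> halo_action D \<xi> g \<alpha>"

lemma halo_carrier: "\<alpha> \<in> halo D \<Longrightarrow> \<alpha> \<in> carrier D"
  and rprod_halo: "\<lbrakk>\<alpha> \<in> halo D; x \<in> carrier D\<rbrakk> \<Longrightarrow> x \<stileturn> \<alpha> = x"
  and halo_lprod: "\<lbrakk>\<alpha> \<in> halo D; x \<in> carrier D\<rbrakk> \<Longrightarrow> \<alpha> \<turnstile> x = x"
  by (simp_all add: halo_def)

lemma left_group_mult: "x \<otimes>\<^bsub>G\<^esub> y = x \<stileturn> y"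
  and left_group_one: "\<one>\<^bsub>G\<^esub> = \<xi>"
  by (simp_all add: left_group_def)

text \<open>The map x \<mapsto> \<xi> \<stileturn> x is idempotent because \<xi> \<stileturn> \<xi>
  = \<xi>, so its image is its set of fixed points. The equational form makes membership in
  \<open>G\<close> accessible to rewriting.\<close>

lemma left_group_carrier_iff: "g \<in> carrier G \<longleftrightarrow> g \<in> carrier D \<and> \<xi> \<stileturn> g = g"
proof
  assume "g \<in> carrier G"
  then obtain x where "x \<in> carrier D" "g = \<xi> \<stileturn> x" by (auto simp: left_group_def)
  then show "g \<in> carrier D \<and> \<xi> \<stileturn> g = g"
    using base_in_halo
    by (metis halo_carrier rprod_assoc rprod_closed rprod_halo)
next
  assume "g \<in> carrier D \<and> \<xi> \<stileturn> g = g"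
  then show "g \<in> carrier G" by (force simp: left_group_def)
qed

lemma base_rprod_in_left_group: "x \<in> carrier D \<Longrightarrow> \<xi> \<stileturn> x \<in> carrier G"
  by (auto simp: left_group_def)

sublocale left_group: group G
proof (rule groupI)
  fix x y assume "x \<in> carrier G" "y \<in> carrier G"
  then show "x \<otimes>\<^bsub>G\<^esub> y \<in> carrier G"
    using base_in_halo
    by (simp add: left_group_carrier_iff left_group_mult rprod_closed halo_carrier
        flip: rprod_assoc)
next
  show "\<one>\<^bsub>G\<^esub> \<in> carrier G"
    using base_in_halo by (simp add: left_group_carrier_iff left_group_one halo_carrier rprod_halo)
next
  fix x y z assume "x \<in> carrier G" "y \<in> carrier G" "z \<in> carrier G"
  then show "x \<otimes>\<^bsub>G\<^esub> y \<otimes>\<^bsub>G\<^esub> z = x \<otimes>\<^bsub>G\<^esub> (y \<otimes>\<^bsub>G\<^esub> z)"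
    by (simp add: left_group_carrier_iff left_group_mult rprod_assoc)
next
  fix x assume "x \<in> carrier G"
  then show "\<one>\<^bsub>G\<^esub> \<otimes>\<^bsub>G\<^esub> x = x"
    by (simp add: left_group_carrier_iff left_group_mult left_group_one)
next
  fix x assume "x \<in> carrier G"
  then have x: "x \<in> carrier D" by (simp add: left_group_carrier_iff)
  then obtain y where y: "y \<in> carrier D" "y \<stileturn> x = \<xi>"
    using left_inverse base_in_halo by blast
  \<comment> \<open>The left inverse \<open>y\<close> may lie outside \<open>G\<close>; its
    projection \<xi> \<stileturn> y lies in \<open>G\<close> and is still a left inverse.\<close>
  then have "(\<xi> \<stileturn> y) \<stileturn> x = \<xi>"
    using x base_in_halo by (simp add: rprod_assoc halo_carrier rprod_halo)
  then show "\<exists>y\<in>carrier G. y \<otimes>\<^bsub>G\<^esub> x = \<one>\<^bsub>G\<^esub>"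
    using base_rprod_in_left_group[OF y(1)] by (auto simp: left_group_mult left_group_one)
qed

lemma left_group_carrier: "g \<in> carrier G \<Longrightarrow> g \<in> carrier D"
  by (simp add: left_group_carrier_iff)

lemma left_group_inv_carrier: "g \<in> carrier G \<Longrightarrow> inv\<^bsub>G\<^esub> g \<in> carrier D"
  by (simp add: left_group_carrier)

lemma left_group_inv_rprod:
  assumes "g \<in> carrier G"
  shows "inv\<^bsub>G\<^esub> g \<stileturn> g = \<xi>" and "g \<stileturn> inv\<^bsub>G\<^esub> g = \<xi>"
  using left_group.l_inv[OF assms] left_group.r_inv[OF assms]
  by (simp_all add: left_group_mult left_group_one)

text \<open>Here \<open>x\<close> ranges over all of \<open>D\<close>: associativity leaves x
  \<stileturn> \<xi>, and the bar-unit \<xi> is right neutral on \<open>D\<close>, not only on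
  \<open>G\<close>.\<close>

lemma rprod_cancel_inv:
  assumes "g \<in> carrier G" "x \<in> carrier D"
  shows "(x \<stileturn> g) \<stileturn> inv\<^bsub>G\<^esub> g = x" and "(x \<stileturn> inv\<^bsub>G\<^esub> g) \<stileturn> g = x"
  using assms base_in_halo
  by (simp_all add: rprod_assoc left_group_carrier left_group_inv_rprod rprod_halo)

text \<open>Inverses in \<open>G\<close> are taken with respect to \<stileturn>. They also cancel
  under \<turnstile> because \<open>left_bar\<close> makes the two products agree inside a left
  factor of \<turnstile>.\<close>

lemma lprod_cancel_inv:
  assumes "g \<in> carrier G" "x \<in> carrier D"
  shows "g \<turnstile> (inv\<^bsub>G\<^esub> g \<turnstile> x) = x"
proof -
  have "g \<turnstile> (inv\<^bsub>G\<^esub> g \<turnstile> x) = (g \<stileturn> inv\<^bsub>G\<^esub> g) \<turnstile> x"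
    using assms by (simp add: left_group_carrier left_bar flip: lprod_assoc)
  then show ?thesis using assms base_in_halo by (simp add: left_group_inv_rprod halo_lprod)
qed

text \<open>The bar axioms allow either product inside a right factor of \<stileturn> or a left
  factor of \<turnstile>. In each case the right choice makes the bar-unit \<alpha> vanish, and
  \<open>g\<close> then cancels against its inverse.\<close>

lemma action_in_halo:
  assumes g: "g \<in> carrier G" and \<alpha>: "\<alpha> \<in> halo D"
  shows "g \<bullet> \<alpha> \<in> halo D"
proof -
  note c = left_group_carrier[OF g] left_group_inv_carrier[OF g] halo_carrier[OF \<alpha>]
  have "x \<stileturn> ((g \<turnstile> \<alpha>) \<stileturn> inv\<^bsub>G\<^esub> g) = x" if x: "x \<in> carrier D" for x
  proof -
    have "x \<stileturn> ((g \<turnstile> \<alpha>) \<stileturn> inv\<^bsub>G\<^esub> g) = (x \<stileturn> (g \<turnstile> \<alpha>)) \<stileturn> inv\<^bsub>G\<^esub> g"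
      using c x by (simp add: rprod_assoc lprod_closed)
    also have "x \<stileturn> (g \<turnstile> \<alpha>) = x \<stileturn> (g \<stileturn> \<alpha>)"
      using c x by (simp add: right_bar)
    finally show ?thesis using c x g \<alpha> by (simp add: rprod_halo rprod_cancel_inv)
  qed
  moreover have "((g \<turnstile> \<alpha>) \<stileturn> inv\<^bsub>G\<^esub> g) \<turnstile> x = x" if x: "x \<in> carrier D" for x
  proof -
    have "((g \<turnstile> \<alpha>) \<stileturn> inv\<^bsub>G\<^esub> g) \<turnstile> x = ((g \<turnstile> \<alpha>) \<turnstile> inv\<^bsub>G\<^esub> g) \<turnstile> x"
      using c x left_bar[of "g \<turnstile> \<alpha>" "inv\<^bsub>G\<^esub> g" x] by (simp add: lprod_closed)
    then show ?thesis
      using c x g \<alpha> by (simp add: lprod_assoc lprod_closed halo_lprod lprod_cancel_inv)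
  qed
  ultimately show ?thesis using c by (simp add: halo_action_def halo_def lprod_closed rprod_closed)
qed

text \<open>This recovers the \<open>G\<close>-coordinate: \<alpha> vanishes as a right factor of
  \<stileturn>.\<close>

lemma base_rprod_rprod:
  assumes "g \<in> carrier G" "\<alpha> \<in> halo D"
  shows "\<xi> \<stileturn> (\<alpha> \<stileturn> g) = g"
  using assms base_in_halo left_group_carrier_iff
  by (simp add: halo_carrier rprod_halo flip: rprod_assoc)

text \<open>Multiplying by \<xi> on the left gives g = h; cancelling \<open>g\<close> on the right
  then gives \<alpha> = \<beta>.\<close>

lemma halo_rprod_eq_iff:
  assumes "g \<in> carrier G" "h \<in> carrier G" "\<alpha> \<in> halo D" "\<beta> \<in> halo D"
  shows "\<alpha> \<stileturn> g = \<beta> \<stileturn> h \<longleftrightarrow> g = h \<and> \<alpha> = \<beta>"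
  using assms by (metis base_rprod_rprod halo_carrier rprod_cancel_inv(1))

text \<open>This element is the halo component of the structure isomorphism: the inverse of \<xi>
  \<stileturn> x in \<open>G\<close> is a left inverse of \<open>x\<close> relative to
  \<xi>.\<close>

lemma rprod_inv_in_halo:
  assumes x: "x \<in> carrier D"
  shows "x \<stileturn> inv\<^bsub>G\<^esub> (\<xi> \<stileturn> x) \<in> halo D"
proof -
  define g where "g = \<xi> \<stileturn> x"
  have g: "g \<in> carrier G" by (simp add: g_def base_rprod_in_left_group x)
  note c = left_group_carrier[OF g] left_group_inv_carrier[OF g] halo_carrier[OF base_in_halo] x
  have "y \<stileturn> (x \<stileturn> inv\<^bsub>G\<^esub> g) = y" if y: "y \<in> carrier D" for y
  proof -
    \<comment> \<open>As right factors of \<stileturn>, \<open>x\<close> and its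
      \<open>G\<close>-coordinate are indistinguishable.\<close>
    have "y \<stileturn> x = y \<stileturn> g"
      using c y base_in_halo by (simp add: g_def rprod_halo flip: rprod_assoc)
    then show ?thesis using c y g by (simp add: rprod_cancel_inv flip: rprod_assoc)
  qed
  moreover have "(x \<stileturn> inv\<^bsub>G\<^esub> g) \<turnstile> y = y" if y: "y \<in> carrier D" for y
  proof -
    have "(x \<stileturn> inv\<^bsub>G\<^esub> g) \<turnstile> y = (x \<turnstile> inv\<^bsub>G\<^esub> g) \<turnstile> y"
      using c y by (simp add: left_bar)
    \<comment> \<open>Inserting \<xi> on the left lets \<open>left_bar\<close> turn \<xi>
      \<turnstile> x into \<xi> \<stileturn> x, which is \<open>g\<close>.\<close>
    also have "\<dots> = (\<xi> \<turnstile> x) \<turnstile> (inv\<^bsub>G\<^esub> g \<turnstile> y)"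
      using c y base_in_halo by (simp add: lprod_assoc halo_lprod)
    also have "\<dots> = g \<turnstile> (inv\<^bsub>G\<^esub> g \<turnstile> y)"
      using c y by (simp add: g_def left_bar lprod_closed)
    finally show ?thesis using g y by (simp add: lprod_cancel_inv)
  qed
  ultimately show ?thesis using c by (simp add: halo_def rprod_closed flip: g_def)
qed

lemma bij_betw_rprod:
  "bij_betw (\<lambda>(g, \<alpha>). \<alpha> \<stileturn> g) (carrier G \<times> halo D) (carrier D)"
proof (rule bij_betw_imageI)
  show "inj_on (\<lambda>(g, \<alpha>). \<alpha> \<stileturn> g) (carrier G \<times> halo D)"
    by (auto simp: inj_on_def halo_rprod_eq_iff)
  have "x \<in> (\<lambda>(g, \<alpha>). \<alpha> \<stileturn> g) ` (carrier G \<times> halo D)" if x: "x \<in> carrier D" for x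
  proof (rule image_eqI)
    show "(\<xi> \<stileturn> x, x \<stileturn> inv\<^bsub>G\<^esub> (\<xi> \<stileturn> x)) \<in> carrier G \<times> halo D"
      using x by (simp add: base_rprod_in_left_group rprod_inv_in_halo)
    show "x = (\<lambda>(g, \<alpha>). \<alpha> \<stileturn> g) (\<xi> \<stileturn> x, x \<stileturn> inv\<^bsub>G\<^esub> (\<xi> \<stileturn> x))"
      using x by (simp add: rprod_cancel_inv base_rprod_in_left_group)
  qed
  then show "(\<lambda>(g, \<alpha>). \<alpha> \<stileturn> g) ` (carrier G \<times> halo D) = carrier D"
    by (auto simp: rprod_closed left_group_carrier halo_carrier)
qed

lemma conj_op_rprod:
  assumes g: "g \<in> carrier G" and h: "h \<in> carrier G" and \<alpha>: "\<alpha> \<in> halo D" and \<beta>: "\<beta> \<in> halo D"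
  shows "(\<alpha> \<stileturn> g) \<triangleright> (\<beta> \<stileturn> h) = (g \<bullet> \<beta>) \<stileturn> (g \<otimes>\<^bsub>G\<^esub> h \<otimes>\<^bsub>G\<^esub> inv\<^bsub>G\<^esub> g)"
proof -
  note c = left_group_carrier[OF g] left_group_carrier[OF h] left_group_inv_carrier[OF g]
    halo_carrier[OF \<alpha>] halo_carrier[OF \<beta>]
  \<comment> \<open>The inverse of \<open>g\<close> in \<open>G\<close> is a left inverse of
    \<alpha> \<stileturn> g for every \<alpha>, so it can replace the arbitrary choice made in
    \<open>conj_op\<close>.\<close>
  have "inv\<^bsub>G\<^esub> g \<stileturn> (\<alpha> \<stileturn> g) = \<xi>"
    using c g \<alpha> by (simp add: rprod_halo left_group_inv_rprod flip: rprod_assoc)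
  then have "one_sided_inverse D (\<alpha> \<stileturn> g) (inv\<^bsub>G\<^esub> g)"
    using c base_in_halo by (auto simp: one_sided_inverse_def)
  then have "(\<alpha> \<stileturn> g) \<triangleright> (\<beta> \<stileturn> h) = ((\<alpha> \<stileturn> g) \<turnstile> (\<beta> \<stileturn> h)) \<stileturn> inv\<^bsub>G\<^esub> g"
    using c by (simp add: conj_op_eq rprod_closed)
  also have "(\<alpha> \<stileturn> g) \<turnstile> (\<beta> \<stileturn> h) = (\<alpha> \<turnstile> g) \<turnstile> (\<beta> \<stileturn> h)"
    using c by (simp add: left_bar rprod_closed)
  also have "\<dots> = (g \<turnstile> \<beta>) \<stileturn> h"
    using c \<alpha> by (simp add: halo_lprod inner_assoc)
  \<comment> \<open>Splitting g \<turnstile> \<beta> into its halo and group coordinates leaves the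
    factors \<open>g\<close>, \<open>h\<close> and the inverse of \<open>g\<close> on the right,
    which form the conjugate of \<open>h\<close>.\<close>
  also have "g \<turnstile> \<beta> = (g \<bullet> \<beta>) \<stileturn> g"
    using c g by (simp add: halo_action_def rprod_cancel_inv lprod_closed)
  finally show ?thesis
    using c halo_carrier[OF action_in_halo[OF g \<beta>]]
    by (simp add: left_group_mult rprod_assoc rprod_closed)
qed

lemma conjugate_eq_iff:
  assumes "g \<in> carrier G" "h \<in> carrier G"
  shows "g \<otimes>\<^bsub>G\<^esub> h \<otimes>\<^bsub>G\<^esub> inv\<^bsub>G\<^esub> g = h \<longleftrightarrow> g \<otimes>\<^bsub>G\<^esub> h = h \<otimes>\<^bsub>G\<^esub> g"
  using assms left_group.inv_solve_right'[of h "g \<otimes>\<^bsub>G\<^esub> h" g] by auto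

lemma card_fixed_points_left_translation:
  assumes g: "g \<in> carrier G" and \<alpha>: "\<alpha> \<in> halo D"
  shows "card (fixed_points (carrier D) (left_translation D (\<alpha> \<stileturn> g))) =
    card (centralizer G g) * card (fixed_points (halo D) (halo_action D \<xi> g))"
proof -
  let ?f = "\<lambda>(h, \<beta>). \<beta> \<stileturn> h"
  let ?F = "fixed_points (carrier D) (left_translation D (\<alpha> \<stileturn> g))"
  let ?C = "centralizer G g \<times> fixed_points (halo D) (halo_action D \<xi> g)"
  \<comment> \<open>By \<open>action_in_halo\<close> the translated element is again in coordinate
    form, so uniqueness of coordinates splits the fixed-point equation into one condition on
    \<open>h\<close> and one on \<beta>.\<close>
  have iff: "left_translation D (\<alpha> \<stileturn> g) (\<beta> \<stileturn> h) = \<beta> \<stileturn> h \<longleftrightarrow>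
      g \<otimes>\<^bsub>G\<^esub> h = h \<otimes>\<^bsub>G\<^esub> g \<and> g \<bullet> \<beta> = \<beta>"
    if "h \<in> carrier G" "\<beta> \<in> halo D" for h \<beta>
    using that g \<alpha>
    by (simp add: left_translation_def conj_op_rprod halo_rprod_eq_iff action_in_halo conjugate_eq_iff)
  have sub: "?C \<subseteq> carrier G \<times> halo D"
    by (auto simp: centralizer_def fixed_points_def)
  have "?F = {y \<in> ?f ` (carrier G \<times> halo D). left_translation D (\<alpha> \<stileturn> g) y = y}"
    by (simp add: fixed_points_def bij_betw_imp_surj_on[OF bij_betw_rprod])
  also have "\<dots> = ?f ` ?C"
    by (force simp: centralizer_def fixed_points_def iff)
  finally have "card ?F = card ?C"
    using inj_on_subset[OF bij_betw_imp_inj_on[OF bij_betw_rprod] sub] by (simp add: card_image)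
  then show ?thesis by (simp add: card_cartesian_product)
qed

end

theorem corollary4p4:
  fixes D :: "('a, 'm) digroup_scheme" and \<xi> :: 'a
  assumes "generalized_digroup D"
    and "finite (carrier D)"
    and "\<xi> \<in> halo D"
  shows "Phi D = of_nat (card (halo D)) *
    (\<Sum>g \<in> carrier (left_group D \<xi>).
      monom 1 (card (centralizer (left_group D \<xi>) g) *
               card (fixed_points (halo D) (halo_action D \<xi> g))))"
proof -
  interpret pointed_digroup D \<xi>
    using assms(1,3) by (simp add: pointed_digroup_def pointed_digroup_axioms_def)
  let ?m = "\<lambda>g. monom (1 :: int) (card (centralizer G g) *
    card (fixed_points (halo D) (halo_action D \<xi> g)))"
  have "Phi D = (\<Sum>(g, \<alpha>) \<in> carrier G \<times> halo D.
      monom 1 (card (fixed_points (carrier D) (left_translation D (\<alpha> \<stileturn>\<^bsub>D\<^esub> g)))))"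
    unfolding Phi_def by (subst sum.reindex_bij_betw[OF bij_betw_rprod, symmetric])
      (simp add: case_prod_unfold)
  also have "\<dots> = (\<Sum>(g, \<alpha>) \<in> carrier G \<times> halo D. ?m g)"
    by (intro sum.cong) (auto simp: card_fixed_points_left_translation)
  also have "\<dots> = (\<Sum>g \<in> carrier G. \<Sum>\<alpha> \<in> halo D. ?m g)"
    by (rule sum.cartesian_product[symmetric])
  \<comment> \<open>The inner summand is constant in \<alpha>, so each inner sum contributes the
    factor \<open>card (halo D)\<close>.\<close>
  also have "\<dots> = of_nat (card (halo D)) * (\<Sum>g \<in> carrier G. ?m g)"
    by (simp add: sum_distrib_left)
  finally show ?thesis .
qed

end
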